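(* Let $\alpha,r$ be complex numbers and $n\ge 0$ an integer. The degenerate Bernoulli polynomials of the second kind satisfy $$B_{n}(r\mid\alpha)=\sum_{k=0}^{n}S_{2}(n,k,r\mid\alpha)\frac{(-1)^{k}k!}{k+1}.$$
   Context: All generating functions are formal power series in $t$; $(1+\alpha t)^{c/\alpha}=\exp\left(\frac{c}{\alpha}\log(1+\alpha t)\right)$, and for $\alpha=0$ one interprets $(1+\alpha t)^{c/\alpha}$ as $e^{ct}$ and $\frac1\alpha\log(1+\alpha t)$ as $t$. The degenerate Bernoulli polynomials of the second kind $B_n(x\mid\alpha)$ are defined by $$\sum_{n=0}^{\infty}B_{n}(x\mid\alpha)\frac{t^{n}}{n!}=\frac{\frac{1}{\alpha}\log(1+\alpha t)}{(1+\alpha t)^{1/\alpha}-1}(1+\alpha t)^{x/\alpha}.$$ Howard's degenerate weighted Stirling numbers of the second kind $S_2(n,k,r\mid\alpha)$ are defined by $$\left((1+\alpha t)^{1/\alpha}-1\right)^{k}(1+\alpha t)^{r/\alpha}=k!\sum_{n=0}^{\infty}S_{2}(n,k,r\mid\alpha)\frac{t^{n}}{n!}.$$ *)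

theory Defs
  imports Complex_Main "HOL-Computational_Algebra.Formal_Power_Series"
begin

text \<open>
  All series are formal power series in \<open>t\<close> (that is, \<^term>\<open>fps_X\<close>) over the complex numbers.
  \<^term>\<open>fps_ln 1\<close> is the series \<open>log (1 + t)\<close>.
\<close>

text \<open>The series \<open>(1/\<alpha>) log (1 + \<alpha> t)\<close>, read as \<open>t\<close> for \<open>\<alpha> = 0\<close>.\<close>
definition deg_log :: "complex \<Rightarrow> complex fps" where
  "deg_log \<alpha> =
     (if \<alpha> = 0 then fps_X
      else fps_const (1 / \<alpha>) * (fps_ln 1 oo (fps_const \<alpha> * fps_X)))"

text \<open>
  The series \<open>(1 + \<alpha> t)\<^bsup>c/\<alpha>\<^esup> = exp ((c/\<alpha>) log (1 + \<alpha> t))\<close>, read as \<open>e\<^bsup>c t\<^esup>\<close> for \<open>\<alpha> = 0\<close>.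
\<close>
definition deg_pow :: "complex \<Rightarrow> complex \<Rightarrow> complex fps" where
  "deg_pow \<alpha> c =
     (if \<alpha> = 0 then fps_exp c
      else fps_exp 1 oo (fps_const (c / \<alpha>) * (fps_ln 1 oo (fps_const \<alpha> * fps_X))))"

text \<open>
  \<open>deg_bernoulli n x \<alpha>\<close> is \<open>B\<^sub>n(x | \<alpha>)\<close>. The series \<^term>\<open>deg_log \<alpha>\<close> and \<^term>\<open>deg_pow \<alpha> 1 - 1\<close>
  both have zero constant coefficient and linear coefficient 1, so the division of formal
  power series below is exact.
\<close>
definition deg_bernoulli :: "nat \<Rightarrow> complex \<Rightarrow> complex \<Rightarrow> complex" where
  "deg_bernoulli n x \<alpha> =
     fact n * fps_nth (deg_log \<alpha> / (deg_pow \<alpha> 1 - 1) * deg_pow \<alpha> x) n"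

text \<open>\<open>deg_stirling2 n k r \<alpha>\<close> is Howard's \<open>S\<^sub>2(n, k, r | \<alpha>)\<close>.\<close>
definition deg_stirling2 :: "nat \<Rightarrow> nat \<Rightarrow> complex \<Rightarrow> complex \<Rightarrow> complex" where
  "deg_stirling2 n k r \<alpha> =
     fact n / fact k * fps_nth ((deg_pow \<alpha> 1 - 1) ^ k * deg_pow \<alpha> r) n"

end

theory Submission
  imports Defs
begin

text \<open>
  Put \<open>u = (1 + \<alpha> t)\<^bsup>1/\<alpha>\<^esup> - 1\<close>. Then \<open>(1/\<alpha>) log (1 + \<alpha> t) = log (1 + u)\<close>, so the
  generating function of the Bernoulli polynomials is \<open>log (1 + u) / u\<close> times
  \<open>(1 + \<alpha> t)\<^bsup>r/\<alpha>\<^esup>\<close>. Expanding \<open>log (1 + u) / u = \<Sum>\<^sub>k (-1)\<^sup>k u\<^sup>k / (k + 1)\<close> and comparing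
  coefficients gives the formula.
\<close>

unbundle fps_syntax

text \<open>As \<open>u\<close> has no constant term, \<open>u ^ k\<close> has no coefficient below
  degree \<open>k\<close>; hence the sums for all coefficients up to \<open>n\<close> can share the
  bound \<open>n\<close> and be swapped.\<close>

lemma fps_compose_mult_nth:
  fixes f u p :: "'a :: comm_ring_1 fps"
  assumes "u $ 0 = 0"
  shows "((f oo u) * p) $ n = (\<Sum>k=0..n. f $ k * (u ^ k * p) $ n)"
proof -
  have "(f oo u) $ i = (\<Sum>k=0..n. f $ k * u ^ k $ i)" if "i \<le> n" for i
    unfolding fps_compose_nth using that assms
    by (intro sum.mono_neutral_left) (auto simp: startsby_zero_power_prefix)
  then have "((f oo u) * p) $ n = (\<Sum>i=0..n. \<Sum>k=0..n. f $ k * u ^ k $ i * p $ (n - i))"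
    by (simp add: fps_mult_nth sum_distrib_right)
  also have "\<dots> = (\<Sum>k=0..n. f $ k * (u ^ k * p) $ n)"
    by (subst sum.swap) (simp add: fps_mult_nth sum_distrib_left mult.assoc)
  finally show ?thesis .
qed

lemma fps_ln_compose_fps_exp_minus_1:
  "fps_ln 1 oo (fps_exp 1 - 1) = (fps_X :: 'a :: field_char_0 fps)"
  by (simp add: fps_ln_fps_exp_inv fps_inv)

lemma fps_ln_eq_X_mult:
  "fps_ln 1 = fps_X * Abs_fps (\<lambda>k. (-1) ^ k / (of_nat k + 1) :: 'a :: field_char_0)"
proof (rule fps_ext)
  fix n
  show "fps_ln 1 $ n = (fps_X * Abs_fps (\<lambda>k. (-1) ^ k / (of_nat k + 1) :: 'a)) $ n"
    by (cases n) (simp_all add: fps_ln_nth add.commute)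
qed

lemma deg_log_nth_0: "deg_log \<alpha> $ 0 = 0"
  by (simp add: deg_log_def)

lemma deg_log_nth_1: "deg_log \<alpha> $ 1 = 1"
  by (simp add: deg_log_def fps_compose_linear fps_ln_nth)

text \<open>For exponent 1 the argument of exp is \<open>deg_log \<alpha>\<close> itself, also when
  \<open>\<alpha> = 0\<close>, which spares later case splits.\<close>

lemma deg_pow_1_eq: "deg_pow \<alpha> 1 = fps_exp 1 oo deg_log \<alpha>"
  by (simp add: deg_pow_def deg_log_def)

lemma fps_ln_compose_deg_pow: "fps_ln 1 oo (deg_pow \<alpha> 1 - 1) = deg_log \<alpha>"
proof -
  have "deg_pow \<alpha> 1 - 1 = (fps_exp 1 - 1) oo deg_log \<alpha>"
    by (simp add: deg_pow_1_eq fps_compose_sub_distrib)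
  then have "fps_ln 1 oo (deg_pow \<alpha> 1 - 1) = (fps_ln 1 oo (fps_exp 1 - 1)) oo deg_log \<alpha>"
    by (simp add: fps_compose_assoc deg_log_nth_0)
  then show ?thesis
    by (simp add: fps_ln_compose_fps_exp_minus_1 deg_log_nth_0)
qed

lemma deg_log_divide_deg_pow:
  "deg_log \<alpha> / (deg_pow \<alpha> 1 - 1) =
    Abs_fps (\<lambda>k. (-1) ^ k / (of_nat k + 1)) oo (deg_pow \<alpha> 1 - 1)"
  (is "_ / ?u = ?g oo _")
proof -
  have u0: "?u $ 0 = 0"
    by (simp add: deg_pow_1_eq)
  \<comment> \<open>Substituting \<open>?u\<close> for \<open>fps_X\<close> in log (1 + X) = X g(X)
    turns the division into a cancellation.\<close>
  have log_eq: "deg_log \<alpha> = ?u * (?g oo ?u)"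
    using u0 by (simp flip: fps_ln_compose_deg_pow
        add: fps_ln_eq_X_mult fps_compose_mult_distrib)
  \<comment> \<open>Otherwise \<open>log_eq\<close> would make \<open>deg_log \<alpha>\<close>
    vanish, against its linear coefficient 1.\<close>
  moreover have "?u \<noteq> 0"
    using log_eq deg_log_nth_1[of \<alpha>] by auto
  ultimately show ?thesis
    by (metis nonzero_mult_div_cancel_left)
qed

theorem theorem3:
  fixes \<alpha> r :: complex and n :: nat
  shows "deg_bernoulli n r \<alpha> =
    (\<Sum>k=0..n. deg_stirling2 n k r \<alpha> * ((-1) ^ k * fact k / (of_nat k + 1)))"
proof -
  have "(deg_pow \<alpha> 1 - 1) $ 0 = 0"
    by (simp add: deg_pow_1_eq)
  from fps_compose_mult_nth[OF this] show ?thesis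
    unfolding deg_bernoulli_def deg_stirling2_def deg_log_divide_deg_pow
    by (simp add: sum_distrib_left mult_ac)
qed

end
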